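(* Let $X=(W,Q,\pi,I)$ be a root independent irreducible quadruple (an object of $\mathscr D$). The category $\mathcal L_X$ is isomorphic to a subcategory of the subquiver category $\mathcal S_X$.
   Context: Quadruples. For a Coxeter group $W$ of finite rank with simple reflections $s_1,\dots,s_n$, let $V$ be the real vector space with basis the simple roots $\alpha_1,\dots,\alpha_n$, with the form $\langle\alpha_i,\alpha_j\rangle=-\cos(\pi/\operatorname{ord}(s_is_j))$ and the usual geometric action of $W$. Write $[m]=\{1,\dots,m\}$. For a word $Q=s_{i_1}\cdots s_{i_m}$ and $\pi\in W$, the subword complex $\mathcal{SC}_W(Q,\pi)$ has as faces the subsets $I\subseteq[m]$ such that the subword of $Q$ at positions $[m]\setminus I$ contains a reduced expression of $\pi$. A quadruple is $X=(W,Q,\pi,I)$ with $I$ a maximal face of $\mathcal{SC}_W(Q,\pi)$. The root function is $r(l)=\big(\prod_{j\in[l-1]\setminus I}s_{i_j}\big)(\alpha_{i_l})$, $l\in[m]$ (product in increasing order of $j$). $X$ is irreducible if $\{r(i)\}_{i\in I}$ spans $V$; it is moreover root independent if $\{r(i)\}_{i\in I}$ is a basis of $V$. Root configuration quiver. $\Gamma_X$ has vertex set (labelled by) $I$, and there is a (single) arrow $i\to j$ if and only if $(i-j)\cdot\langle r(i),r(j)\rangle>0$. The subobjects of $X$ are indexed by subsets $J\subseteq I$; the subobject $X(J)$ (given by the irreducible flat $\{i\in[m]:r(i)\in\operatorname{span}\{r(j):j\in J\}\}$) has root configuration quiver $\Gamma_{X(J)}$, identified with the full subquiver of $\Gamma_X$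 on $J$. A label-preserving partial isomorphism between $I$-labelled quivers $A$ and $B$ is a diagram $A\hookleftarrow P\hookrightarrow B$ given by an $I$-labelled quiver $P$ identified, preserving labels, with a (full) subquiver of $A$ and a (full) subquiver of $B$; the composite of $A\hookleftarrow P\hookrightarrow B$ and $B\hookleftarrow P'\hookrightarrow C$ is given by the intersection of $P$ and $P'$ in $B$. $\mathcal L_X$: objects are labelled (full) subquivers of $\Gamma_X$; morphisms are label-preserving partial isomorphisms (for which $P$ is a subquiver of both). $\mathcal S_X$: objects are finite disjoint unions $\bigsqcup_{i=1}^t\Gamma_{X_i}$ of labelled quivers, where each $X_i$ is a subobject $X(J_i)$ of $X$, $J_i\subseteq I$ (repetitions allowed); morphisms are label-preserving partial isomorphisms. *)

theory Defs
  imports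
    "HOL-Analysis.Finite_Function_Topology"
    "HOL-Algebra.Multiplicative_Group"
    "HOL-Algebra.Generated_Groups"
    "HOL-Library.Sublist"
begin

section \<open>Coxeter systems\<close>

text \<open>
  The simple reflections form a finite subset \<open>S\<close> of the carrier, and a word is a list over \<open>S\<close>.
\<close>

definition word_prod :: "('w, 'b) monoid_scheme \<Rightarrow> 'w list \<Rightarrow> 'w" where
  "word_prod W ws = foldr (\<lambda>x y. x \<otimes>\<^bsub>W\<^esub> y) ws \<one>\<^bsub>W\<^esub>"

text \<open>
  The congruence on words over \<open>S\<close> generated by \<open>(s t)\<^bsup>ord(s t)\<^esup> = 1\<close> for \<open>s, t \<in> S\<close>.
  The library's \<open>group.ord\<close> is \<open>0\<close> for elements of infinite order, and the relation is then
  void.  The case \<open>s = t\<close> yields \<open>s s = 1\<close>, so the quotient is the group with this presentation.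
\<close>

inductive coxeter_rel :: "('w, 'b) monoid_scheme \<Rightarrow> 'w set \<Rightarrow> 'w list \<Rightarrow> 'w list \<Rightarrow> bool"
  for W S where
  relator: "\<lbrakk>s \<in> S; t \<in> S; u \<in> lists S; v \<in> lists S\<rbrakk> \<Longrightarrow>
     coxeter_rel W S (u @ concat (replicate (group.ord W (s \<otimes>\<^bsub>W\<^esub> t)) [s, t]) @ v) (u @ v)"
| refl: "u \<in> lists S \<Longrightarrow> coxeter_rel W S u u"
| sym: "coxeter_rel W S u v \<Longrightarrow> coxeter_rel W S v u"
| trans: "\<lbrakk>coxeter_rel W S u v; coxeter_rel W S v w\<rbrakk> \<Longrightarrow> coxeter_rel W S u w"

definition coxeter_system :: "('w, 'b) monoid_scheme \<Rightarrow> 'w set \<Rightarrow> bool" where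
  "coxeter_system W S \<longleftrightarrow>
     group W \<and> finite S \<and> S \<subseteq> carrier W \<and> \<one>\<^bsub>W\<^esub> \<notin> S \<and> (\<forall>s\<in>S. s \<otimes>\<^bsub>W\<^esub> s = \<one>\<^bsub>W\<^esub>) \<and>
     generate W S = carrier W \<and>
     (\<forall>u\<in>lists S. \<forall>v\<in>lists S. word_prod W u = word_prod W v \<longrightarrow> coxeter_rel W S u v)"

definition reduced_expression :: "('w, 'b) monoid_scheme \<Rightarrow> 'w set \<Rightarrow> 'w \<Rightarrow> 'w list \<Rightarrow> bool" where
  "reduced_expression W S w ws \<longleftrightarrow>
     ws \<in> lists S \<and> word_prod W ws = w \<and>
     (\<forall>vs\<in>lists S. word_prod W vs = w \<longrightarrow> length ws \<le> length vs)"

section \<open>The geometric representation\<close>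

text \<open>\<open>V\<close> consists of the formal real combinations of elements of \<open>S\<close>; it lives inside
  \<^typ>\<open>'w \<Rightarrow>\<^sub>0 real\<close>.\<close>

definition root_space :: "'w set \<Rightarrow> ('w \<Rightarrow>\<^sub>0 real) set" where
  "root_space S = {v. Poly_Mapping.keys v \<subseteq> S}"

definition simple_root :: "'w \<Rightarrow> ('w \<Rightarrow>\<^sub>0 real)" where
  "simple_root s = Poly_Mapping.single s 1"

text \<open>If \<open>s t\<close> has infinite order, then \<open>pi / 0 = 0\<close> gives the value \<open>-1\<close>, which agrees with
  the convention \<open>pi / \<infinity> = 0\<close>.\<close>

definition coxeter_form ::
  "('w, 'b) monoid_scheme \<Rightarrow> 'w set \<Rightarrow> ('w \<Rightarrow>\<^sub>0 real) \<Rightarrow> ('w \<Rightarrow>\<^sub>0 real) \<Rightarrow> real" where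
  "coxeter_form W S x y =
     (\<Sum>s\<in>S. \<Sum>t\<in>S. Poly_Mapping.lookup x s * Poly_Mapping.lookup y t *
        (- cos (pi / real (group.ord W (s \<otimes>\<^bsub>W\<^esub> t)))))"

text \<open>Action of \<open>s \<in> S\<close>; there is no denominator because \<open>\<langle>\<alpha>\<^sub>s, \<alpha>\<^sub>s\<rangle> = - cos pi = 1\<close>.\<close>

definition simple_reflection ::
  "('w, 'b) monoid_scheme \<Rightarrow> 'w set \<Rightarrow> 'w \<Rightarrow> ('w \<Rightarrow>\<^sub>0 real) \<Rightarrow> ('w \<Rightarrow>\<^sub>0 real)" where
  "simple_reflection W S s v = v - (2 * coxeter_form W S (simple_root s) v) *\<^sub>R simple_root s"

text \<open>The product of a word acts as the composite of the actions of its letters.\<close>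

definition word_action ::
  "('w, 'b) monoid_scheme \<Rightarrow> 'w set \<Rightarrow> 'w list \<Rightarrow> ('w \<Rightarrow>\<^sub>0 real) \<Rightarrow> ('w \<Rightarrow>\<^sub>0 real)" where
  "word_action W S ws v = foldr (simple_reflection W S) ws v"

section \<open>Quadruples\<close>

text \<open>
  Positions in a word \<open>Q\<close> are counted from \<open>0\<close>, so \<open>{..<length Q}\<close> plays the role of \<open>[m]\<close>;
  only differences of positions and their order are ever used.
\<close>

definition subword_complex ::
  "('w, 'b) monoid_scheme \<Rightarrow> 'w set \<Rightarrow> 'w list \<Rightarrow> 'w \<Rightarrow> nat set set" where
  "subword_complex W S Q p =
     {I. I \<subseteq> {..<length Q} \<and>
         (\<exists>ws. subseq ws (nths Q ({..<length Q} - I)) \<and> reduced_expression W S p ws)}"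

record 'w quadruple =
  cox_group :: "'w monoid"
  cox_gens :: "'w set"
  cox_word :: "'w list"
  cox_elt :: "'w"
  cox_facet :: "nat set"

definition quadruple :: "'w quadruple \<Rightarrow> bool" where
  "quadruple X \<longleftrightarrow>
     coxeter_system (cox_group X) (cox_gens X) \<and>
     cox_word X \<in> lists (cox_gens X) \<and>
     cox_elt X \<in> carrier (cox_group X) \<and>
     (let K = subword_complex (cox_group X) (cox_gens X) (cox_word X) (cox_elt X)
      in cox_facet X \<in> K \<and> (\<forall>J\<in>K. cox_facet X \<subseteq> J \<longrightarrow> J = cox_facet X))"

definition root_fun :: "'w quadruple \<Rightarrow> nat \<Rightarrow> ('w \<Rightarrow>\<^sub>0 real)" where
  "root_fun X l =
     word_action (cox_group X) (cox_gens X)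
       (nths (cox_word X) ({..<l} - cox_facet X)) (simple_root (cox_word X ! l))"

abbreviation quad_form :: "'w quadruple \<Rightarrow> ('w \<Rightarrow>\<^sub>0 real) \<Rightarrow> ('w \<Rightarrow>\<^sub>0 real) \<Rightarrow> real" where
  "quad_form X \<equiv> coxeter_form (cox_group X) (cox_gens X)"

definition irreducible_quadruple :: "'w quadruple \<Rightarrow> bool" where
  "irreducible_quadruple X \<longleftrightarrow>
     quadruple X \<and> span (root_fun X ` cox_facet X) = root_space (cox_gens X)"

text \<open>Being a basis is a property of the family, hence the injectivity clause.\<close>

definition root_independent :: "'w quadruple \<Rightarrow> bool" where
  "root_independent X \<longleftrightarrow>
     irreducible_quadruple X \<and>
     inj_on (root_fun X) (cox_facet X) \<and> independent (root_fun X ` cox_facet X)"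

section \<open>Labelled quivers\<close>

text \<open>Quivers here have at most one arrow between any ordered pair of vertices.\<close>

record ('v, 'l) lquiver =
  verts :: "'v set"
  arrows :: "('v \<times> 'v) set"
  label :: "'v \<Rightarrow> 'l"

text \<open>Labels are normalised to \<^const>\<open>undefined\<close> off the vertex set, so that equality of
  records is equality of labelled quivers.\<close>

definition lquiver_on :: "'l set \<Rightarrow> ('v, 'l) lquiver \<Rightarrow> bool" where
  "lquiver_on L A \<longleftrightarrow>
     arrows A \<subseteq> verts A \<times> verts A \<and> label A \<in> verts A \<rightarrow>\<^sub>E L"

definition full_subquiver :: "('v, 'l) lquiver \<Rightarrow> 'v set \<Rightarrow> ('v, 'l) lquiver" where
  "full_subquiver A U =
     \<lparr>verts = verts A \<inter> U, arrows = arrows A \<inter> (U \<times> U),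
      label = restrict (label A) (verts A \<inter> U)\<rparr>"

definition disjoint_union :: "('v, 'l) lquiver list \<Rightarrow> (nat \<times> 'v, 'l) lquiver" where
  "disjoint_union As =
     (let U = (SIGMA k:{..<length As}. verts (As ! k)) in
      \<lparr>verts = U,
       arrows = {((k, u), (k, v)) | k u v. k < length As \<and> (u, v) \<in> arrows (As ! k)},
       label = restrict (\<lambda>(k, v). label (As ! k) v) U\<rparr>)"

text \<open>\<open>h\<close> identifies \<open>P\<close>, preserving labels, with a full subquiver of \<open>A\<close>.\<close>

definition full_embedding ::
  "('p \<Rightarrow> 'v) \<Rightarrow> ('p, 'l) lquiver \<Rightarrow> ('v, 'l) lquiver \<Rightarrow> bool" where
  "full_embedding h P A \<longleftrightarrow>
     inj_on h (verts P) \<and> h ` verts P \<subseteq> verts A \<and>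
     (\<forall>p\<in>verts P. label P p = label A (h p)) \<and>
     (\<forall>p\<in>verts P. \<forall>q\<in>verts P. (p, q) \<in> arrows P \<longleftrightarrow> (h p, h q) \<in> arrows A)"

text \<open>
  A partial isomorphism is a diagram of full embeddings \<open>A \<leftarrow> P \<rightarrow> B\<close>, where only the way in which
  \<open>P\<close> sits in \<open>A\<close> and \<open>B\<close> matters.  Every such diagram is isomorphic to exactly one in which
  a vertex of \<open>P\<close> is the pair of its images in \<open>A\<close> and \<open>B\<close> and the legs are the projections;
  these representatives are used.
\<close>

record ('v, 'l) partial_iso =
  source :: "('v, 'l) lquiver"
  apex :: "('v \<times> 'v, 'l) lquiver"
  target :: "('v, 'l) lquiver"

definition partial_iso :: "'l set \<Rightarrow> ('v, 'l) partial_iso \<Rightarrow> bool" where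
  "partial_iso L f \<longleftrightarrow>
     lquiver_on L (source f) \<and> lquiver_on L (apex f) \<and> lquiver_on L (target f) \<and>
     full_embedding fst (apex f) (source f) \<and> full_embedding snd (apex f) (target f)"

definition partial_iso_id :: "('v, 'l) lquiver \<Rightarrow> ('v, 'l) partial_iso" where
  "partial_iso_id A =
     \<lparr>source = A,
      apex = \<lparr>verts = Id_on (verts A),
              arrows = {((u, u), (v, v)) | u v. (u, v) \<in> arrows A},
              label = restrict (\<lambda>(u, v). label A u) (Id_on (verts A))\<rparr>,
      target = A\<rparr>"

text \<open>
  Composite of \<open>f : A \<leftarrow> P \<rightarrow> B\<close> and \<open>g : B \<leftarrow> P' \<rightarrow> C\<close>: its apex is the intersection of \<open>P\<close> and
  \<open>P'\<close> in \<open>B\<close>, with each common vertex renamed to the pair of its images in \<open>A\<close> and \<open>C\<close>.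
\<close>

definition partial_iso_comp ::
  "('v, 'l) partial_iso \<Rightarrow> ('v, 'l) partial_iso \<Rightarrow> ('v, 'l) partial_iso" where
  "partial_iso_comp g f =
     (let U = verts (apex f) O verts (apex g) in
      \<lparr>source = source f,
       apex = \<lparr>verts = U,
               arrows = {((a, c), (a', c')) | a c a' c'. \<exists>b b'.
                  ((a, b), (a', b')) \<in> arrows (apex f) \<and> ((b, c), (b', c')) \<in> arrows (apex g)},
               label = restrict (\<lambda>(a, c). label (source f) a) U\<rparr>,
       target = target g\<rparr>)"

section \<open>Categories\<close>

record ('o, 'm) cat =
  ob :: "'o set"
  mor :: "'m set"
  src :: "'m \<Rightarrow> 'o"
  tgt :: "'m \<Rightarrow> 'o"
  idn :: "'o \<Rightarrow> 'm"
  cmp :: "'m \<Rightarrow> 'm \<Rightarrow> 'm"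

text \<open>\<open>cmp C g f\<close> is \<open>g\<close> after \<open>f\<close>; it is meaningful only if \<open>tgt C f = src C g\<close>.\<close>

definition category :: "('o, 'm) cat \<Rightarrow> bool" where
  "category C \<longleftrightarrow>
     (\<forall>f\<in>mor C. src C f \<in> ob C \<and> tgt C f \<in> ob C) \<and>
     (\<forall>a\<in>ob C. idn C a \<in> mor C \<and> src C (idn C a) = a \<and> tgt C (idn C a) = a) \<and>
     (\<forall>f\<in>mor C. \<forall>g\<in>mor C. tgt C f = src C g \<longrightarrow>
        cmp C g f \<in> mor C \<and> src C (cmp C g f) = src C f \<and> tgt C (cmp C g f) = tgt C g) \<and>
     (\<forall>f\<in>mor C. cmp C f (idn C (src C f)) = f \<and> cmp C (idn C (tgt C f)) f = f) \<and>
     (\<forall>f\<in>mor C. \<forall>g\<in>mor C. \<forall>h\<in>mor C. tgt C f = src C g \<and> tgt C g = src C h \<longrightarrow>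
        cmp C h (cmp C g f) = cmp C (cmp C h g) f)"

definition subcategory :: "('o, 'm) cat \<Rightarrow> ('o, 'm) cat \<Rightarrow> bool" where
  "subcategory D C \<longleftrightarrow>
     category D \<and> category C \<and> ob D \<subseteq> ob C \<and> mor D \<subseteq> mor C \<and>
     (\<forall>f\<in>mor D. src D f = src C f \<and> tgt D f = tgt C f) \<and>
     (\<forall>a\<in>ob D. idn D a = idn C a) \<and>
     (\<forall>f\<in>mor D. \<forall>g\<in>mor D. tgt D f = src D g \<longrightarrow> cmp D g f = cmp C g f)"

definition cat_functor ::
  "('o, 'm) cat \<Rightarrow> ('p, 'n) cat \<Rightarrow> ('o \<Rightarrow> 'p) \<Rightarrow> ('m \<Rightarrow> 'n) \<Rightarrow> bool" where
  "cat_functor C D Fo Fm \<longleftrightarrow>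
     category C \<and> category D \<and> Fo ` ob C \<subseteq> ob D \<and> Fm ` mor C \<subseteq> mor D \<and>
     (\<forall>f\<in>mor C. src D (Fm f) = Fo (src C f) \<and> tgt D (Fm f) = Fo (tgt C f)) \<and>
     (\<forall>a\<in>ob C. Fm (idn C a) = idn D (Fo a)) \<and>
     (\<forall>f\<in>mor C. \<forall>g\<in>mor C. tgt C f = src C g \<longrightarrow> Fm (cmp C g f) = cmp D (Fm g) (Fm f))"

definition isomorphic_categories :: "('o, 'm) cat \<Rightarrow> ('p, 'n) cat \<Rightarrow> bool" where
  "isomorphic_categories C D \<longleftrightarrow>
     (\<exists>Fo Fm. cat_functor C D Fo Fm \<and>
        bij_betw Fo (ob C) (ob D) \<and> bij_betw Fm (mor C) (mor D))"

definition partial_iso_category ::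
  "('v, 'l) lquiver set \<Rightarrow> ('v, 'l) partial_iso set \<Rightarrow>
     (('v, 'l) lquiver, ('v, 'l) partial_iso) cat" where
  "partial_iso_category Obs Mors =
     \<lparr>ob = Obs, mor = {f \<in> Mors. source f \<in> Obs \<and> target f \<in> Obs},
      src = source, tgt = target, idn = partial_iso_id, cmp = partial_iso_comp\<rparr>"

section \<open>The root configuration quiver and its categories\<close>

text \<open>Each vertex is its own label.\<close>

definition root_quiver :: "'w quadruple \<Rightarrow> (nat, nat) lquiver" where
  "root_quiver X =
     \<lparr>verts = cox_facet X,
      arrows = {(i, j). i \<in> cox_facet X \<and> j \<in> cox_facet X \<and>
                  (real i - real j) * quad_form X (root_fun X i) (root_fun X j) > 0},
      label = restrict (\<lambda>i. i) (cox_facet X)\<rparr>"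

text \<open>
  A subobject \<open>X(J)\<close> enters only through its root configuration quiver, the full subquiver of
  \<^term>\<open>root_quiver X\<close> on the facet positions in the flat spanned by \<open>J\<close>.  The lemma below shows
  that for root independent \<open>X\<close> these positions are just \<open>J\<close>.
\<close>

definition subobject_flat :: "'w quadruple \<Rightarrow> nat set \<Rightarrow> nat set" where
  "subobject_flat X J = {i. i < length (cox_word X) \<and> root_fun X i \<in> span (root_fun X ` J)}"

definition subobject_quiver :: "'w quadruple \<Rightarrow> nat set \<Rightarrow> (nat, nat) lquiver" where
  "subobject_quiver X J = full_subquiver (root_quiver X) (cox_facet X \<inter> subobject_flat X J)"

lemma subobject_quiver_eq:
  assumes "root_independent X" "J \<subseteq> cox_facet X"
  shows "subobject_quiver X J = full_subquiver (root_quiver X) J"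
proof -
  have inj: "inj_on (root_fun X) (cox_facet X)"
    and ind: "independent (root_fun X ` cox_facet X)"
    and len: "cox_facet X \<subseteq> {..<length (cox_word X)}"
    using assms(1)
    by (auto simp: root_independent_def irreducible_quadruple_def quadruple_def
        subword_complex_def Let_def)
  have "i \<in> J" if i: "i \<in> cox_facet X" "root_fun X i \<in> span (root_fun X ` J)" for i
  proof (rule ccontr)
    assume "i \<notin> J"
    then have "root_fun X ` J \<subseteq> root_fun X ` cox_facet X - {root_fun X i}"
      using inj i(1) assms(2) by (auto dest: inj_onD)
    then have "root_fun X i \<in> span (root_fun X ` cox_facet X - {root_fun X i})"
      using i(2) span_mono by blast
    then show False
      using ind i(1) by (auto simp: dependent_def)
  qed
  then have "cox_facet X \<inter> subobject_flat X J = J"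
    using assms(2) len by (auto simp: subobject_flat_def intro: span_base)
  then show ?thesis
    by (simp add: subobject_quiver_def)
qed

text \<open>The condition on the apex says that \<open>P\<close> is a common subquiver, included identically in both
  quivers.\<close>

definition labelled_subquiver_category ::
  "'w quadruple \<Rightarrow> ((nat, nat) lquiver, (nat, nat) partial_iso) cat" where
  "labelled_subquiver_category X =
     partial_iso_category
       {full_subquiver (root_quiver X) J | J. J \<subseteq> cox_facet X}
       {f. partial_iso (cox_facet X) f \<and> verts (apex f) \<subseteq> Id}"

definition subquiver_category ::
  "'w quadruple \<Rightarrow> ((nat \<times> nat, nat) lquiver, (nat \<times> nat, nat) partial_iso) cat" where
  "subquiver_category X =
     partial_iso_category
       {disjoint_union (map (subobject_quiver X) Js) | Js. \<forall>J\<in>set Js. J \<subseteq> cox_facet X}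
       {f. partial_iso (cox_facet X) f}"

end

theory Submission
  imports Defs
begin

text \<open>
  A labelled subquiver of the root configuration quiver is the quiver of a subobject, because \<open>X\<close>
  is root independent, and so it is a disjoint union with a single summand.  Sending
  \<open>A\<close> to the one-term union of \<open>A\<close> only renames each vertex \<open>v\<close> to \<open>(0, v)\<close>.  Renaming along an
  injection commutes with everything from which the categories are built: full embeddings,
  identities and intersections of apexes.  It can also be undone, on quivers and on partial
  isomorphisms.  It is therefore a functor that is injective on objects and morphisms
  (\<open>transport_functor\<close>, \<open>transport_iso_inj\<close>), and the image of such a functor is a subcategory
  isomorphic to its domain (\<open>image_of_injective_functor\<close>).

  Both categories consist of labelled quivers and partial isomorphisms, so that the category
  axioms are checked once, for any class of partial isomorphisms closed under identities and
  composition (\<open>category_partial_iso_category\<close>).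
\<close>

section \<open>Images of injective functors\<close>

text \<open>Injectivity on objects matters even for closure under composition: without it, morphisms
  that are not composable in \<open>C\<close> may become composable in the image.  It follows from injectivity
  on morphisms, since an object is the source of its identity.\<close>

lemma image_of_injective_functor:
  fixes E :: "('p, 'n) cat"
  assumes F: "cat_functor C E Fo Fm" and inj: "inj_on Fm (mor C)"
  shows "\<exists>D :: ('p, 'n) cat. subcategory D E \<and> isomorphic_categories C D"
proof -
  define D where "D = E\<lparr>ob := Fo ` ob C, mor := Fm ` mor C\<rparr>"
  have C: "category C" and E: "category E"
    and Fo: "\<And>a. a \<in> ob C \<Longrightarrow> Fo a \<in> ob E" and Fm: "\<And>f. f \<in> mor C \<Longrightarrow> Fm f \<in> mor E"
    and st: "\<And>f. f \<in> mor C \<Longrightarrow> src E (Fm f) = Fo (src C f) \<and> tgt E (Fm f) = Fo (tgt C f)"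
    and ids: "\<And>a. a \<in> ob C \<Longrightarrow> Fm (idn C a) = idn E (Fo a)"
    and cmps: "\<And>f g. \<lbrakk>f \<in> mor C; g \<in> mor C; tgt C f = src C g\<rbrakk> \<Longrightarrow>
                 Fm (cmp C g f) = cmp E (Fm g) (Fm f)"
    using F by (auto simp: cat_functor_def)
  have Cob: "\<And>f. f \<in> mor C \<Longrightarrow> src C f \<in> ob C \<and> tgt C f \<in> ob C"
    and Cid: "\<And>a. a \<in> ob C \<Longrightarrow> idn C a \<in> mor C \<and> src C (idn C a) = a"
    and Ccmp: "\<And>f g. \<lbrakk>f \<in> mor C; g \<in> mor C; tgt C f = src C g\<rbrakk> \<Longrightarrow> cmp C g f \<in> mor C"
    using C by (auto simp: category_def)
  have injo: "inj_on Fo (ob C)"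
  proof (rule inj_onI)
    fix a b assume "a \<in> ob C" "b \<in> ob C" "Fo a = Fo b"
    then have "idn C a = idn C b"
      using ids Cid inj by (metis inj_onD)
    then show "a = b"
      using Cid \<open>a \<in> ob C\<close> \<open>b \<in> ob C\<close> by metis
  qed
  have comp_closed: "cmp E g f \<in> Fm ` mor C"
    if fg: "f \<in> Fm ` mor C" "g \<in> Fm ` mor C" "tgt E f = src E g" for f g
  proof -
    obtain f0 g0 where 0: "f0 \<in> mor C" "g0 \<in> mor C" "f = Fm f0" "g = Fm g0"
      using fg by blast
    then have "tgt C f0 = src C g0"
      using fg(3) st Cob injo by (auto dest: inj_onD)
    then show ?thesis
      using 0 cmps Ccmp by (metis image_eqI)
  qed
  have Ecat: "\<And>f g. \<lbrakk>f \<in> mor E; g \<in> mor E; tgt E f = src E g\<rbrakk> \<Longrightarrow>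
                 src E (cmp E g f) = src E f \<and> tgt E (cmp E g f) = tgt E g"
    "\<And>f g h. \<lbrakk>f \<in> mor E; g \<in> mor E; h \<in> mor E; tgt E f = src E g; tgt E g = src E h\<rbrakk> \<Longrightarrow>
                 cmp E h (cmp E g f) = cmp E (cmp E h g) f"
    "\<And>a. a \<in> ob E \<Longrightarrow> src E (idn E a) = a \<and> tgt E (idn E a) = a"
    using E by (auto simp: category_def)
  have unit: "cmp E (Fm f) (idn E (Fo (src C f))) = Fm f \<and>
      cmp E (idn E (Fo (tgt C f))) (Fm f) = Fm f" if "f \<in> mor C" for f
    using E Fm[OF that] st[OF that] unfolding category_def by metis
  have D: "category D"
    unfolding category_def D_def
  proof (intro conjI ballI impI, goal_cases)
    case (3 a)
    then obtain a0 where "a0 \<in> ob C" "a = Fo a0" by auto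
    then have "idn E a = Fm (idn C a0)" "idn C a0 \<in> mor C" using ids Cid by auto
    then show ?case by simp
  next
    case (6 f g)
    then show ?case using comp_closed by simp
  qed (use st Cob Fo Fm Ecat unit in auto)
  have "subcategory D E"
    unfolding subcategory_def using D E Fo Fm by (auto simp: D_def)
  moreover have "cat_functor C D Fo Fm"
    unfolding cat_functor_def using C D st ids cmps by (auto simp: D_def)
  then have "isomorphic_categories C D"
    unfolding isomorphic_categories_def using inj injo
    by (intro exI[of _ Fo] exI[of _ Fm]) (simp add: D_def bij_betw_def)
  ultimately show ?thesis by blast
qed

section \<open>Categories of partial isomorphisms\<close>

lemma full_embeddingD:
  assumes "full_embedding h P A"
  shows "inj_on h (verts P)"
    and "p \<in> verts P \<Longrightarrow> h p \<in> verts A"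
    and "p \<in> verts P \<Longrightarrow> label P p = label A (h p)"
    and "\<lbrakk>p \<in> verts P; q \<in> verts P\<rbrakk> \<Longrightarrow> (p, q) \<in> arrows P \<longleftrightarrow> (h p, h q) \<in> arrows A"
  using assms by (auto simp: full_embedding_def)

lemma lquiver_onD:
  assumes "lquiver_on L A"
  shows "(u, v) \<in> arrows A \<Longrightarrow> u \<in> verts A \<and> v \<in> verts A"
    and "v \<in> verts A \<Longrightarrow> label A v \<in> L"
    and "v \<notin> verts A \<Longrightarrow> label A v = undefined"
  using assms by (auto simp: lquiver_on_def PiE_def extensional_def)

lemma partial_isoD:
  assumes "partial_iso L f"
  shows "lquiver_on L (source f)" "lquiver_on L (apex f)" "lquiver_on L (target f)"
    and "full_embedding fst (apex f) (source f)" "full_embedding snd (apex f) (target f)"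
  using assms by (auto simp: partial_iso_def)

text \<open>Since the legs of a partial isomorphism are the projections, its apex is the graph of a partial
  bijection between the vertices of its ends that preserves and reflects arrows.\<close>

lemma partial_iso_apex:
  assumes "partial_iso L f"
  shows "((a, b), (a', b')) \<in> arrows (apex f) \<longleftrightarrow>
           (a, b) \<in> verts (apex f) \<and> (a', b') \<in> verts (apex f) \<and> (a, a') \<in> arrows (source f)"
    and "((a, b), (a', b')) \<in> arrows (apex f) \<longleftrightarrow>
           (a, b) \<in> verts (apex f) \<and> (a', b') \<in> verts (apex f) \<and> (b, b') \<in> arrows (target f)"
    and "(a, b) \<in> verts (apex f) \<Longrightarrow> a \<in> verts (source f) \<and> b \<in> verts (target f)"
    and "(a, b) \<in> verts (apex f) \<Longrightarrow> label (apex f) (a, b) = label (source f) a"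
    and "(a, b) \<in> verts (apex f) \<Longrightarrow> label (source f) a = label (target f) b"
    and "\<lbrakk>(a, b) \<in> verts (apex f); (a, b') \<in> verts (apex f)\<rbrakk> \<Longrightarrow> b = b'"
    and "\<lbrakk>(a, b) \<in> verts (apex f); (a', b) \<in> verts (apex f)\<rbrakk> \<Longrightarrow> a = a'"
proof -
  note fst_emb = full_embeddingD[OF partial_isoD(4)[OF assms]]
    and snd_emb = full_embeddingD[OF partial_isoD(5)[OF assms]]
    and ends = lquiver_onD(1)[OF partial_isoD(2)[OF assms]]
  show "((a, b), (a', b')) \<in> arrows (apex f) \<longleftrightarrow>
      (a, b) \<in> verts (apex f) \<and> (a', b') \<in> verts (apex f) \<and> (a, a') \<in> arrows (source f)"
    using fst_emb(4)[of "(a, b)" "(a', b')"] ends[of "(a, b)" "(a', b')"] by auto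
  show "((a, b), (a', b')) \<in> arrows (apex f) \<longleftrightarrow>
      (a, b) \<in> verts (apex f) \<and> (a', b') \<in> verts (apex f) \<and> (b, b') \<in> arrows (target f)"
    using snd_emb(4)[of "(a, b)" "(a', b')"] ends[of "(a, b)" "(a', b')"] by auto
  show "(a, b) \<in> verts (apex f) \<Longrightarrow> a \<in> verts (source f) \<and> b \<in> verts (target f)"
    using fst_emb(2)[of "(a, b)"] snd_emb(2)[of "(a, b)"] by simp
  show "(a, b) \<in> verts (apex f) \<Longrightarrow> label (apex f) (a, b) = label (source f) a"
    using fst_emb(3)[of "(a, b)"] by simp
  show "(a, b) \<in> verts (apex f) \<Longrightarrow> label (source f) a = label (target f) b"
    using fst_emb(3)[of "(a, b)"] snd_emb(3)[of "(a, b)"] by simp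
  show "\<lbrakk>(a, b) \<in> verts (apex f); (a, b') \<in> verts (apex f)\<rbrakk> \<Longrightarrow> b = b'"
    using inj_onD[OF fst_emb(1), of "(a, b)" "(a, b')"] by simp
  show "\<lbrakk>(a, b) \<in> verts (apex f); (a', b) \<in> verts (apex f)\<rbrakk> \<Longrightarrow> a = a'"
    using inj_onD[OF snd_emb(1), of "(a, b)" "(a', b)"] by simp
qed

text \<open>An apex carries no information beyond its vertex set: its arrows and labels are those of the
  source.\<close>

lemma partial_iso_eqI:
  fixes f g :: "('v, 'l) partial_iso"
  assumes f: "partial_iso L f" and g: "partial_iso L g"
    and eq: "source f = source g" "target f = target g" "verts (apex f) = verts (apex g)"
  shows "f = g"
proof -
  have "arrows (apex f) = arrows (apex g)"
    using partial_iso_apex(1)[OF f] partial_iso_apex(1)[OF g] eq by auto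
  moreover have "label (apex f) p = label (apex g) p" for p
  proof (cases "p \<in> verts (apex f)")
    case True
    then show ?thesis
      using partial_iso_apex(4)[OF f] partial_iso_apex(4)[OF g] eq by (cases p) auto
  next
    case False
    then show ?thesis
      using lquiver_onD(3)[OF partial_isoD(2)[OF f]] lquiver_onD(3)[OF partial_isoD(2)[OF g]] eq
      by auto
  qed
  then have "label (apex f) = label (apex g)" ..
  ultimately show ?thesis
    using eq by (auto intro!: partial_iso.equality lquiver.equality)
qed

lemma partial_iso_id:
  assumes "lquiver_on L A"
  shows "partial_iso L (partial_iso_id A)"
  using lquiver_onD[OF assms] assms
  by (auto simp: partial_iso_def partial_iso_id_def full_embedding_def inj_on_def lquiver_on_def)

lemma partial_iso_comp:
  assumes f: "partial_iso L f" and g: "partial_iso L g" and "target f = source g"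
  shows "partial_iso L (partial_iso_comp g f)"
proof -
  note F = partial_iso_apex[OF f] and G = partial_iso_apex[OF g]
  let ?U = "verts (apex f) O verts (apex g)"
  let ?P = "apex (partial_iso_comp g f)"
  have V: "verts ?P = ?U" and lab: "label ?P = restrict (\<lambda>(a, c). label (source f) a) ?U"
    and st: "source (partial_iso_comp g f) = source f" "target (partial_iso_comp g f) = target g"
    by (simp_all add: partial_iso_comp_def Let_def)
  have arr: "((a, c), (a', c')) \<in> arrows ?P \<longleftrightarrow> (\<exists>b b'.
      ((a, b), (a', b')) \<in> arrows (apex f) \<and> ((b, c), (b', c')) \<in> arrows (apex g))" for a c a' c'
    by (simp add: partial_iso_comp_def Let_def)
  have Feq: "(a, a') \<in> arrows (source f) \<longleftrightarrow> (b, b') \<in> arrows (source g)"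
    if "(a, b) \<in> verts (apex f)" "(a', b') \<in> verts (apex f)" for a a' b b'
    using F(1)[of a b a' b'] F(2)[of a b a' b'] that assms(3) by simp
  have Geq: "(b, b') \<in> arrows (source g) \<longleftrightarrow> (c, c') \<in> arrows (target g)"
    if "(b, c) \<in> verts (apex g)" "(b', c') \<in> verts (apex g)" for b b' c c'
    using G(1)[of b c b' c'] G(2)[of b c b' c'] that by simp
  have arr0: "((a, c), (a', c')) \<in> arrows ?P \<longleftrightarrow> (\<exists>b b'.
      (a, b) \<in> verts (apex f) \<and> (a', b') \<in> verts (apex f) \<and>
      (b, c) \<in> verts (apex g) \<and> (b', c') \<in> verts (apex g) \<and> (b, b') \<in> arrows (source g))"
    for a c a' c'
    unfolding arr F(2) G(1) assms(3) by blast
  have arr1: "((a, c), (a', c')) \<in> arrows ?P \<longleftrightarrow>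
      (a, c) \<in> ?U \<and> (a', c') \<in> ?U \<and> (a, a') \<in> arrows (source f)" for a c a' c'
    unfolding arr0 using Feq by blast
  have arr2: "((a, c), (a', c')) \<in> arrows ?P \<longleftrightarrow>
      (a, c) \<in> ?U \<and> (a', c') \<in> ?U \<and> (c, c') \<in> arrows (target g)" for a c a' c'
    unfolding arr0 using Geq by blast
  have "lquiver_on L ?P"
    unfolding lquiver_on_def V lab
    using arr1 F(3) lquiver_onD(2)[OF partial_isoD(1)[OF f]] by fastforce
  moreover have "full_embedding fst ?P (source f)"
    unfolding full_embedding_def V lab
    using arr1 F(3,6) G(6) by (auto simp: inj_on_def relcomp_unfold) metis+
  moreover have "full_embedding snd ?P (target g)"
    unfolding full_embedding_def V lab
    using arr2 F(5,7) G(3,5,7) assms(3) by (auto simp: inj_on_def relcomp_unfold) metis+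
  ultimately show ?thesis
    using partial_isoD[OF f] partial_isoD[OF g] by (simp add: partial_iso_def st)
qed

lemma source_target_apex_comp [simp]:
  "source (partial_iso_comp g f) = source f"
  "target (partial_iso_comp g f) = target g"
  "verts (apex (partial_iso_comp g f)) = verts (apex f) O verts (apex g)"
  by (simp_all add: partial_iso_comp_def Let_def)

lemma source_target_apex_id [simp]:
  "source (partial_iso_id A) = A"
  "target (partial_iso_id A) = A"
  "verts (apex (partial_iso_id A)) = Id_on (verts A)"
  by (simp_all add: partial_iso_id_def)

text \<open>Since a partial isomorphism is determined by its ends and its apex vertices, the category
  axioms reduce to those of relational composition.\<close>

lemma category_partial_iso_category:
  assumes obs: "\<And>A. A \<in> Obs \<Longrightarrow> lquiver_on L A"
    and mors: "\<And>f. f \<in> Mors \<Longrightarrow> partial_iso L f"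
    and ids: "\<And>A. A \<in> Obs \<Longrightarrow> partial_iso_id A \<in> Mors"
    and comps: "\<And>f g. \<lbrakk>f \<in> Mors; g \<in> Mors; target f = source g\<rbrakk> \<Longrightarrow>
                  partial_iso_comp g f \<in> Mors"
  shows "category (partial_iso_category Obs Mors)"
proof -
  have unit: "partial_iso_comp f (partial_iso_id (source f)) = f"
    "partial_iso_comp (partial_iso_id (target f)) f = f" if "f \<in> Mors" for f
    using partial_isoD[OF mors[OF that]] partial_iso_apex(3)[OF mors[OF that]] mors[OF that]
    by (auto simp: relcomp_unfold Id_on_iff intro!: partial_iso_eqI[of L] partial_iso_comp partial_iso_id)
  have assoc: "partial_iso_comp h (partial_iso_comp g f) = partial_iso_comp (partial_iso_comp h g) f"
    if "f \<in> Mors" "g \<in> Mors" "h \<in> Mors" "target f = source g" "target g = source h" for f g h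
    using that by (intro partial_iso_eqI[of L] partial_iso_comp) (auto simp: O_assoc intro: mors)
  show ?thesis
    unfolding category_def partial_iso_category_def cat.simps
    using unit assoc ids comps by auto
qed

section \<open>Renaming vertices\<close>

definition transport :: "('v \<Rightarrow> 'u) \<Rightarrow> ('v, 'l) lquiver \<Rightarrow> ('u, 'l) lquiver" where
  "transport g A =
     \<lparr>verts = g ` verts A, arrows = map_prod g g ` arrows A,
      label = restrict (\<lambda>u. label A (inv_into UNIV g u)) (g ` verts A)\<rparr>"

definition transport_iso :: "('v \<Rightarrow> 'u) \<Rightarrow> ('v, 'l) partial_iso \<Rightarrow> ('u, 'l) partial_iso" where
  "transport_iso g f =
     \<lparr>source = transport g (source f), apex = transport (map_prod g g) (apex f),
      target = transport g (target f)\<rparr>"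

lemma transport_simps:
  "verts (transport g A) = g ` verts A"
  "arrows (transport g A) = map_prod g g ` arrows A"
  by (simp_all add: transport_def)

lemma transport_iso_simps [simp]:
  "source (transport_iso g f) = transport g (source f)"
  "target (transport_iso g f) = transport g (target f)"
  "apex (transport_iso g f) = transport (map_prod g g) (apex f)"
  by (simp_all add: transport_iso_def)

lemma label_transport:
  "\<lbrakk>inj g; v \<in> verts A\<rbrakk> \<Longrightarrow> label (transport g A) (g v) = label A v"
  by (simp add: transport_def)

lemma arrows_transport_iff:
  "inj g \<Longrightarrow> (g u, g v) \<in> arrows (transport g A) \<longleftrightarrow> (u, v) \<in> arrows A"
  by (auto simp: transport_def inj_eq)

lemma lquiver_on_transport:
  assumes "inj g" "lquiver_on L A"
  shows "lquiver_on L (transport g A)"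
  using assms by (fastforce simp: lquiver_on_def transport_def)

lemma transport_inj:
  assumes "inj g" and A: "lquiver_on L A" and B: "lquiver_on L B"
    and eq: "transport g A = transport g B"
  shows "A = B"
proof -
  have "verts A = verts B" "arrows A = arrows B"
    using arg_cong[OF eq, of verts] arg_cong[OF eq, of arrows] \<open>inj g\<close>
    by (simp_all add: transport_simps inj_image_eq_iff prod.inj_map)
  moreover have "label A v = label B v" for v
    using label_transport[OF \<open>inj g\<close>, of v A] label_transport[OF \<open>inj g\<close>, of v B] eq
      lquiver_onD(3)[OF A, of v] lquiver_onD(3)[OF B, of v] \<open>verts A = verts B\<close>
    by (cases "v \<in> verts A") auto
  then have "label A = label B" ..
  ultimately show ?thesis by (auto intro!: lquiver.equality)
qed

lemma full_embedding_transport: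
  assumes "inj g" "inj k" "full_embedding h P A" and comm: "\<And>p. h' (k p) = g (h p)"
  shows "full_embedding h' (transport k P) (transport g A)"
  using full_embeddingD(2-)[OF assms(3)] inj_onD[OF full_embeddingD(1)[OF assms(3)]]
  by (auto simp: full_embedding_def transport_simps(1) comm inj_on_def inj_eq[OF \<open>inj g\<close>]
      label_transport[OF \<open>inj g\<close>] label_transport[OF \<open>inj k\<close>]
      arrows_transport_iff[OF \<open>inj g\<close>] arrows_transport_iff[OF \<open>inj k\<close>]
      intro!: arg_cong[of _ _ k])

lemma partial_iso_transport:
  assumes "inj g" "partial_iso L f"
  shows "partial_iso L (transport_iso g f)"
  using partial_isoD[OF assms(2)] assms(1)
  by (auto simp: partial_iso_def intro!: lquiver_on_transport full_embedding_transport prod.inj_map)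

lemma transport_iso_inj:
  assumes "inj g"
  shows "inj_on (transport_iso g) {f. partial_iso L f}"
proof (rule inj_onI)
  fix f f' assume "f \<in> {f. partial_iso L f}" "f' \<in> {f. partial_iso L f}"
    and eq: "transport_iso g f = transport_iso g f'"
  then have *: "partial_iso L f" "partial_iso L f'" by auto
  show "f = f'"
    using * arg_cong[OF eq, of source] arg_cong[OF eq, of target] arg_cong[OF eq, of apex] assms
    by (auto simp: partial_iso_def intro!: partial_iso.equality
        intro: transport_inj[of g L] transport_inj[of "map_prod g g" L] prod.inj_map)
qed

lemma transport_iso_id:
  assumes "inj g" "lquiver_on L A"
  shows "transport_iso g (partial_iso_id A) = partial_iso_id (transport g A)"
  by (rule partial_iso_eqI[of L])
    (use assms in \<open>auto simp: transport_simps Id_on_def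
      intro!: partial_iso_transport partial_iso_id lquiver_on_transport\<close>)

text \<open>Renaming commutes with the intersection in the middle quiver: a common vertex of the two renamed
  apexes comes from a common vertex of the original ones because the renaming is injective.\<close>

lemma transport_iso_comp:
  assumes "inj g" "partial_iso L f" "partial_iso L f'" "target f = source f'"
  shows "transport_iso g (partial_iso_comp f' f) =
           partial_iso_comp (transport_iso g f') (transport_iso g f)"
proof (rule partial_iso_eqI[of L])
  show "verts (apex (transport_iso g (partial_iso_comp f' f))) =
      verts (apex (partial_iso_comp (transport_iso g f') (transport_iso g f)))"
    using injD[OF \<open>inj g\<close>] by (force simp: transport_simps)
qed (use assms in \<open>auto intro!: partial_iso_transport partial_iso_comp\<close>)

lemma transport_functor:
  assumes g: "inj g"
    and C: "category (partial_iso_category Obs Mors)"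
    and D: "category (partial_iso_category Obs' {f. partial_iso L f})"
    and obs: "\<And>A. A \<in> Obs \<Longrightarrow> lquiver_on L A" "transport g ` Obs \<subseteq> Obs'"
    and mors: "\<And>f. f \<in> Mors \<Longrightarrow> partial_iso L f"
  shows "cat_functor (partial_iso_category Obs Mors)
           (partial_iso_category Obs' {f. partial_iso L f}) (transport g) (transport_iso g)"
proof -
  have "transport_iso g (partial_iso_id A) = partial_iso_id (transport g A)" if "A \<in> Obs" for A
    using transport_iso_id[OF g obs(1)[OF that]] .
  moreover have "transport_iso g (partial_iso_comp f' f) =
      partial_iso_comp (transport_iso g f') (transport_iso g f)"
    if "f \<in> Mors" "f' \<in> Mors" "target f = source f'" for f f'
    using transport_iso_comp[OF g mors mors] that by blast
  moreover have "partial_iso L (transport_iso g f)" if "f \<in> Mors" for f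
    using partial_iso_transport[OF g mors[OF that]] .
  ultimately show ?thesis
    unfolding cat_functor_def using C D obs(2) by (simp add: partial_iso_category_def image_subset_iff)
qed

section \<open>The quiver categories of a quadruple\<close>

lemma lquiver_on_root_quiver: "lquiver_on (cox_facet X) (root_quiver X)"
  by (auto simp: lquiver_on_def root_quiver_def)

lemma lquiver_on_full_subquiver: "lquiver_on L A \<Longrightarrow> lquiver_on L (full_subquiver A U)"
  by (fastforce simp: lquiver_on_def full_subquiver_def)

lemma lquiver_on_disjoint_union:
  assumes "\<And>A. A \<in> set As \<Longrightarrow> lquiver_on L A"
  shows "lquiver_on L (disjoint_union As)"
  using lquiver_onD(1,2)[OF assms[OF nth_mem]]
  by (fastforce simp: lquiver_on_def disjoint_union_def Let_def)

lemma category_labelled_subquiver_category: "category (labelled_subquiver_category X)"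
  unfolding labelled_subquiver_category_def
  by (rule category_partial_iso_category[of _ "cox_facet X"])
    (auto intro: lquiver_on_full_subquiver lquiver_on_root_quiver partial_iso_id partial_iso_comp)

lemma category_subquiver_category: "category (subquiver_category X)"
  unfolding subquiver_category_def
  by (rule category_partial_iso_category[of _ "cox_facet X"])
    (auto simp: subobject_quiver_def intro!: lquiver_on_full_subquiver lquiver_on_root_quiver
      lquiver_on_disjoint_union partial_iso_id partial_iso_comp)

lemma disjoint_union_singleton: "disjoint_union [A] = transport (Pair 0) A"
proof -
  have "inv_into UNIV (Pair (0::nat)) (0, v) = v" for v :: 'a
    by (rule inv_f_f) (auto simp: inj_on_def)
  then show ?thesis
    by (force simp: disjoint_union_def transport_def Let_def intro!: lquiver.equality ext)
qed

theorem proposition3p14: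
  fixes X :: "'w quadruple"
  assumes "quadruple X" and "irreducible_quadruple X" and "root_independent X"
  shows "\<exists>D. subcategory D (subquiver_category X) \<and>
             isomorphic_categories (labelled_subquiver_category X) D"
proof (rule image_of_injective_functor)
  let ?g = "Pair 0 :: nat \<Rightarrow> nat \<times> nat"
  have g: "inj ?g" by (auto simp: inj_on_def)
  have "transport ?g (full_subquiver (root_quiver X) J) =
      disjoint_union (map (subobject_quiver X) [J])" if "J \<subseteq> cox_facet X" for J
    using subobject_quiver_eq[OF assms(3) that] by (simp add: disjoint_union_singleton)
  then have "transport ?g ` {full_subquiver (root_quiver X) J | J. J \<subseteq> cox_facet X}
      \<subseteq> {disjoint_union (map (subobject_quiver X) Js) | Js. \<forall>J\<in>set Js. J \<subseteq> cox_facet X}"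
    by (force intro: exI[of _ "[_]"])
  then show "cat_functor (labelled_subquiver_category X) (subquiver_category X)
      (transport ?g) (transport_iso ?g)"
    using category_labelled_subquiver_category[of X] category_subquiver_category[of X]
    unfolding labelled_subquiver_category_def subquiver_category_def
    by (intro transport_functor[OF g])
      (auto intro: lquiver_on_full_subquiver lquiver_on_root_quiver)
  show "inj_on (transport_iso ?g) (mor (labelled_subquiver_category X))"
    by (rule inj_on_subset[OF transport_iso_inj[OF g, of "cox_facet X"]])
      (auto simp: labelled_subquiver_category_def partial_iso_category_def)
qed

end
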